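(* Let $X\in\mathbb{R}^K$ be a random variable with probability density (or mass) function $f_X(x\mid\theta)$, $\theta\in\Theta\subseteq\mathbb{R}^L$, such that $\theta\neq\theta'$ implies $f_X(\cdot\mid\theta)\neq f_X(\cdot\mid\theta')$. Let $\Theta_1,\Theta_2$ be point sets (singletons) forming a partition of $\Theta$, with hypotheses $H_j:\theta\in\Theta_j$, $j=1,2$, and let $p$ be a probability distribution on $\Theta$ with $p(\Theta_1)\in(0,1)$. Let $\theta$ be drawn from $p$ and, given $\theta$, let $X_1^n=(X_1,\dots,X_n)$ be an i.i.d. sample from $f_X(\cdot\mid\theta)$. Let $S=[k_S,\infty)$ with $k_S>1$. Then the ratio of likelihoods $r_{21}(\neg H_1,H_2,X_1^n)=f_{X_1^n}(X_1^n\mid\Theta_2)/f_{X_1^n}(X_1^n\mid\Theta_1)$ is a consistent measure of evidence against $H_1$ relative to $H_2$, i.e., $$\lim_{n\to\infty}\Pr\bigl(H_1\mid r_{21}(\neg H_1,H_2,X_1^n)\in S\bigr)=0.$$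
   Context: For a singleton $\Theta_j=\{\theta_j\}$, $f_{X_1^n}(x_1^n\mid\Theta_j)=\prod_{i=1}^n f_X(x_i\mid\theta_j)$ is the likelihood of the sample under $\theta_j$. Large values of $r_{21}$ are evidence in favor of $H_2$ and against $H_1$; $S=[k_S,\infty)$, with $k_S>1$ a fixed threshold, is the category of strongest evidence. Two-level sampling: first $\theta$ is drawn from $p$; then, given $\theta$, the random sample $X_1^n$ is drawn from $f_X(\cdot\mid\theta)$. $\Pr(H_1\mid A)$ denotes the conditional probability, under the joint law of $(\theta,X_1^n)$, of the event $\{\theta\in\Theta_1\}$ given the event $A$. A measure of evidence $\epsilon(\neg H_1,H_2,X_1^n)$ against $H_1$ relative to $H_2$, with category $S$ of strongest-evidence values, is called consistent if $\lim_{n\to\infty}\Pr(H_1\mid\epsilon(\neg H_1,H_2,X_1^n)\in S)=0$.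
   Formalization: Where the likelihood under Θ₁ is zero and that under Θ₂ is positive, the ratio is taken to be ∞ and counted as belonging to S, so S is [k_S,∞]; if such samples were left out of S, the claim could fail when f(·|θ₂) has mass outside the support of f(·|θ₁). *)

theory Defs
  imports "HOL-Probability.Probability"
begin

definition is_density :: "'x measure \<Rightarrow> ('x \<Rightarrow> real) \<Rightarrow> bool" where
  "is_density \<nu> g \<longleftrightarrow>
     g \<in> borel_measurable \<nu> \<and> (\<forall>x\<in>space \<nu>. 0 \<le> g x) \<and> (\<integral>\<^sup>+x. ennreal (g x) \<partial>\<nu>) = 1"

text \<open>A family \<open>f\<close> takes the parameter first: \<open>f \<theta> x\<close> is \<open>f(x | \<theta>)\<close>. Samples of size \<open>n\<close> are
  functions on \<open>{1..n}\<close>.\<close>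

definition sample_law :: "'x measure \<Rightarrow> ('t \<Rightarrow> 'x \<Rightarrow> real) \<Rightarrow> nat \<Rightarrow> 't \<Rightarrow> (nat \<Rightarrow> 'x) measure" where
  "sample_law \<nu> f n \<theta> = Pi\<^sub>M {1..n} (\<lambda>_. density \<nu> (\<lambda>x. ennreal (f \<theta> x)))"

definition joint_law ::
    "'x measure \<Rightarrow> ('t \<Rightarrow> 'x \<Rightarrow> real) \<Rightarrow> 't measure \<Rightarrow> nat \<Rightarrow> ('t \<times> (nat \<Rightarrow> 'x)) measure" where
  "joint_law \<nu> f p n =
     bind p (\<lambda>\<theta>. distr (sample_law \<nu> f n \<theta>) (p \<Otimes>\<^sub>M Pi\<^sub>M {1..n} (\<lambda>_. \<nu>)) (\<lambda>x. (\<theta>, x)))"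

text \<open>Only used for singletons \<open>\<Theta>\<^sub>j = {\<theta>\<^sub>j}\<close>, whose element is \<open>the_elem \<Theta>\<^sub>j\<close>.\<close>

definition likelihood :: "('t \<Rightarrow> 'x \<Rightarrow> real) \<Rightarrow> nat \<Rightarrow> (nat \<Rightarrow> 'x) \<Rightarrow> 't set \<Rightarrow> real" where
  "likelihood f n x \<Theta>\<^sub>j = (\<Prod>i=1..n. f (the_elem \<Theta>\<^sub>j) (x i))"

text \<open>The ratio is extended-valued: it is \<open>\<infinity>\<close> where the likelihood under \<open>\<Theta>\<^sub>1\<close> vanishes and the one
  under \<open>\<Theta>\<^sub>2\<close> does not. (Real division would give 0 there, turning conclusive evidence against
  the first hypothesis into the weakest possible value.) The value at 0/0 is 0; for
  \<open>\<theta> \<in> \<Theta>\<^sub>1 \<union> \<Theta>\<^sub>2\<close> such samples form a null set.\<close>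

definition likelihood_ratio ::
    "('t \<Rightarrow> 'x \<Rightarrow> real) \<Rightarrow> 't set \<Rightarrow> 't set \<Rightarrow> nat \<Rightarrow> (nat \<Rightarrow> 'x) \<Rightarrow> ennreal" where
  "likelihood_ratio f \<Theta>\<^sub>1 \<Theta>\<^sub>2 n x =
     ennreal (likelihood f n x \<Theta>\<^sub>2) / ennreal (likelihood f n x \<Theta>\<^sub>1)"

text \<open>\<open>\<epsilon> n x\<close> is the evidence against \<open>H\<^sub>1: \<theta> \<in> \<Theta>\<^sub>1\<close> computed from a sample \<open>x\<close> of size \<open>n\<close>.\<close>

definition consistent_evidence ::
    "'x measure \<Rightarrow> ('t \<Rightarrow> 'x \<Rightarrow> real) \<Rightarrow> 't measure \<Rightarrow> 't set \<Rightarrow>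
     (nat \<Rightarrow> (nat \<Rightarrow> 'x) \<Rightarrow> 'e) \<Rightarrow> 'e set \<Rightarrow> bool" where
  "consistent_evidence \<nu> f p \<Theta>\<^sub>1 \<epsilon> S \<longleftrightarrow>
     (\<lambda>n. \<P>(\<omega> in joint_law \<nu> f p n. fst \<omega> \<in> \<Theta>\<^sub>1 \<bar> \<epsilon> n (snd \<omega>) \<in> S)) \<longlonglongrightarrow> 0"

end

theory Submission
  imports Defs
begin

text \<open>Both error probabilities of the likelihood ratio test decay like the \<open>n\<close>-th power of the
  Hellinger affinity \<open>\<rho> = \<integral> sqrt (f\<^sub>1 f\<^sub>2) d\<nu>\<close>: by Markov's inequality for the square root of the
  ratio, \<open>P\<^sub>1(r \<ge> k) \<le> \<rho>\<^sup>n / sqrt k\<close> and \<open>P\<^sub>2(r < k) \<le> sqrt k \<rho>\<^sup>n\<close>. If \<open>\<rho> < 1\<close>, the posterior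
  probability of \<open>H\<^sub>1\<close> therefore tends to 0. If \<open>\<rho> = 1\<close>, the densities agree almost everywhere
  (distinct functions may be versions of one density), so that \<open>r = 1 < k\<close> almost
  surely under \<open>H\<^sub>1\<close> and the posterior probability is 0 for each \<open>n\<close>.\<close>

section \<open>Hellinger affinity and Hellinger distance of two densities\<close>

definition affinity :: "'x measure \<Rightarrow> ('x \<Rightarrow> real) \<Rightarrow> ('x \<Rightarrow> real) \<Rightarrow> ennreal" where
  "affinity \<nu> f g = (\<integral>\<^sup>+x. ennreal (sqrt (f x * g x)) \<partial>\<nu>)"

lemma affinity_commute: "affinity \<nu> f g = affinity \<nu> g f"
  by (simp add: affinity_def mult.commute)

text \<open>Integrating \<open>2 * sqrt (f x * g x) + (sqrt (f x) - sqrt (g x))\<^sup>2 = f x + g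
  x\<close>. The additive form avoids subtraction in \<open>ennreal\<close>.\<close>

lemma affinity_hellinger:
  assumes f: "is_density \<nu> f" and g: "is_density \<nu> g"
  shows "2 * affinity \<nu> f g + (\<integral>\<^sup>+x. ennreal ((sqrt (f x) - sqrt (g x))\<^sup>2) \<partial>\<nu>) = 2"
proof -
  have [measurable]: "f \<in> borel_measurable \<nu>" "g \<in> borel_measurable \<nu>"
    using f g by (auto simp: is_density_def)
  have pt: "2 * ennreal (sqrt (f x * g x)) + ennreal ((sqrt (f x) - sqrt (g x))\<^sup>2)
      = ennreal (f x) + ennreal (g x)" if "x \<in> space \<nu>" for x
  proof -
    have nn: "f x \<ge> 0" "g x \<ge> 0" using f g that by (auto simp: is_density_def)
    have "2 * ennreal (sqrt (f x * g x)) = ennreal (2 * sqrt (f x * g x))"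
      using nn by (simp add: ennreal_mult)
    moreover have "2 * sqrt (f x * g x) + (sqrt (f x) - sqrt (g x))\<^sup>2 = f x + g x"
      using nn by (simp add: power2_diff real_sqrt_mult)
    ultimately show ?thesis
      using nn by (simp flip: ennreal_plus)
  qed
  have "2 * affinity \<nu> f g + (\<integral>\<^sup>+x. ennreal ((sqrt (f x) - sqrt (g x))\<^sup>2) \<partial>\<nu>)
     = (\<integral>\<^sup>+x. 2 * ennreal (sqrt (f x * g x)) + ennreal ((sqrt (f x) - sqrt (g x))\<^sup>2) \<partial>\<nu>)"
    by (simp add: affinity_def nn_integral_cmult nn_integral_add)
  also have "\<dots> = (\<integral>\<^sup>+x. ennreal (f x) + ennreal (g x) \<partial>\<nu>)"
    by (rule nn_integral_cong) (rule pt)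
  also have "\<dots> = 1 + 1"
    using f g by (simp add: nn_integral_add is_density_def)
  finally show ?thesis by simp
qed

text \<open>An affinity of at least 1 already uses up the total of 2 in the identity above, so the
  squared Hellinger distance is 0.\<close>

lemma affinity_less_1_or_AE_eq:
  assumes f: "is_density \<nu> f" and g: "is_density \<nu> g"
  shows "affinity \<nu> f g < 1 \<or> (AE x in \<nu>. f x = g x)"
proof (cases "affinity \<nu> f g < 1")
  case False
  have [measurable]: "f \<in> borel_measurable \<nu>" "g \<in> borel_measurable \<nu>"
    using f g by (auto simp: is_density_def)
  let ?H = "\<integral>\<^sup>+x. ennreal ((sqrt (f x) - sqrt (g x))\<^sup>2) \<partial>\<nu>"
  have "2 * (1::ennreal) \<le> 2 * affinity \<nu> f g"
    using False by (intro mult_left_mono) auto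
  then have "2 + ?H \<le> 2"
    using affinity_hellinger[OF f g] by (metis add_right_mono mult.right_neutral)
  \<comment> \<open>Cancelling on the left in \<open>ennreal\<close> is sound here because the
    common summand 2 is finite.\<close>
  then have "2 + ?H \<le> 2 + 0" by simp
  then have "?H \<le> 0" by (subst (asm) ennreal_add_left_cancel_le) auto
  then have "AE x in \<nu>. ennreal ((sqrt (f x) - sqrt (g x))\<^sup>2) = 0"
    by (subst (asm) le_zero_eq, subst (asm) nn_integral_0_iff_AE) auto
  then show ?thesis by (auto elim!: eventually_mono simp: ennreal_eq_0_iff)
qed simp

section \<open>Laws of one observation and of samples\<close>

lemma prob_space_density:
  "is_density \<nu> f \<Longrightarrow> prob_space (density \<nu> (\<lambda>x. ennreal (f x)))"
  by (rule prob_spaceI) (auto simp: is_density_def emeasure_density cong: nn_integral_cong)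

text \<open>The zero set of a density has mass 0 under its own law. Hence division by the likelihood
  of the parameter that generates the sample is almost surely genuine.\<close>

lemma AE_density_pos:
  assumes "is_density \<nu> f"
  shows "AE x in density \<nu> (\<lambda>x. ennreal (f x)). 0 < f x"
  using assms by (subst AE_density) (auto simp: is_density_def ennreal_less_zero_iff)

lemma prob_space_sample_law:
  "is_density \<nu> (f \<theta>) \<Longrightarrow> prob_space (sample_law \<nu> f n \<theta>)"
  unfolding sample_law_def by (intro prob_space_PiM prob_space_density)

lemma sets_sample_law [measurable_cong]:
  "sets (sample_law \<nu> f n \<theta>) = sets (Pi\<^sub>M {1..n} (\<lambda>_. \<nu>))"
  unfolding sample_law_def by (intro sets_PiM_cong) auto

lemma space_sample_law: "space (sample_law \<nu> f n \<theta>) = space (Pi\<^sub>M {1..n} (\<lambda>_. \<nu>))"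
  by (rule sets_eq_imp_space_eq) (rule sets_sample_law)

lemma AE_sample_law:
  assumes "is_density \<nu> (f \<theta>)" "AE x in density \<nu> (\<lambda>x. ennreal (f \<theta> x)). P x"
  shows "AE x in sample_law \<nu> f n \<theta>. \<forall>i\<in>{1..n}. P (x i)"
  unfolding sample_law_def
  by (intro AE_finite_allI AE_PiM_component) (use assms in \<open>auto intro: prob_space_density\<close>)

section \<open>Markov bound for the square root of the likelihood ratio\<close>

text \<open>The weight \<open>f x\<close> turns \<open>sqrt (g x / f x)\<close> into
  \<open>sqrt (f x * g x)\<close>, so the affinity is the expected root of the ratio for one
  observation.\<close>

lemma nn_integral_sqrt_ratio:
  assumes f: "is_density \<nu> f" and g: "is_density \<nu> g"
  shows "(\<integral>\<^sup>+x. ennreal (sqrt (g x / f x)) \<partial>density \<nu> (\<lambda>x. ennreal (f x))) = affinity \<nu> f g"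
proof -
  have [measurable]: "f \<in> borel_measurable \<nu>" "g \<in> borel_measurable \<nu>"
    using f g by (auto simp: is_density_def)
  have "ennreal (f x) * ennreal (sqrt (g x / f x)) = ennreal (sqrt (f x * g x))"
    if "x \<in> space \<nu>" for x
  proof -
    have nn: "f x \<ge> 0" "g x \<ge> 0" using f g that by (auto simp: is_density_def)
    have "f x * sqrt (g x / f x) = sqrt (f x * g x)"
      \<comment> \<open>At \<open>f x = 0\<close> both sides are 0, whatever value the quotient
        takes.\<close>
      using nn by (cases "f x = 0") (auto simp: real_sqrt_mult real_sqrt_divide field_simps)
    then show ?thesis using nn by (simp flip: ennreal_mult)
  qed
  then show ?thesis
    unfolding affinity_def by (subst nn_integral_density) (auto intro!: nn_integral_cong)
qed

lemma borel_measurable_likelihood [measurable]: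
  assumes [measurable]: "f \<theta> \<in> borel_measurable \<nu>"
  shows "(\<lambda>x. likelihood f n x {\<theta>}) \<in> borel_measurable (Pi\<^sub>M {1..n} (\<lambda>_. \<nu>))"
  unfolding likelihood_def by simp

lemma real_sqrt_prod: "sqrt (prod h A) = (\<Prod>i\<in>A. sqrt (h i))"
  by (induction A rule: infinite_finite_induct) (auto simp: real_sqrt_mult)

text \<open>Markov's inequality for the root of the likelihood ratio, whose expectation is the
  \<open>n\<close>-th power of the affinity by independence. The event is stated without division
  and with a free constant \<open>c\<close>, so that it serves both kinds of error, with
  \<open>s\<close> and \<open>t\<close> in either order.\<close>

lemma sample_law_affinity_bound:
  assumes f: "is_density \<nu> (f s)" and g: "is_density \<nu> (f t)" and c: "0 < c"
  shows "emeasure (sample_law \<nu> f n s)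
      {x \<in> space (sample_law \<nu> f n s). c * likelihood f n x {s} \<le> likelihood f n x {t}}
    \<le> ennreal (sqrt (1 / c)) * affinity \<nu> (f s) (f t) ^ n"
proof -
  have [measurable]: "f s \<in> borel_measurable \<nu>" "f t \<in> borel_measurable \<nu>"
    using f g by (auto simp: is_density_def)
  let ?M = "sample_law \<nu> f n s"
  let ?D = "density \<nu> (\<lambda>x. ennreal (f s x))"
  let ?A = "{x \<in> space ?M. c * likelihood f n x {s} \<le> likelihood f n x {t}}"
  let ?h = "\<lambda>x. ennreal (sqrt (f t x / f s x))"
  interpret D: prob_space ?D by (rule prob_space_density[OF f])
  interpret product_sigma_finite "\<lambda>_::nat. ?D" by unfold_locales
  have A: "?A \<in> sets ?M" by measurable
  have "emeasure ?M ?A = (\<integral>\<^sup>+x. indicator ?A x \<partial>?M)" using A by simp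
  also have "\<dots> \<le> (\<integral>\<^sup>+x. ennreal (sqrt (1 / c)) * (\<Prod>i=1..n. ?h (x i)) \<partial>?M)"
  \<comment> \<open>The comparison is only almost sure: where some \<open>f s (x i)\<close> is 0,
    the sample lies in \<open>?A\<close>, but the product is 0 because real division by 0 gives
    0.\<close>
  proof (rule nn_integral_mono_AE)
    show "AE x in ?M. indicator ?A x \<le> ennreal (sqrt (1 / c)) * (\<Prod>i=1..n. ?h (x i))"
      using AE_sample_law[of \<nu> f s, OF f AE_density_pos[OF f], of n]
    proof (rule AE_mp, intro AE_I2 impI)
      fix x assume x: "x \<in> space ?M" and pos: "\<forall>i\<in>{1..n}. 0 < f s (x i)"
      have nn: "0 \<le> f t (x i)" if "i \<in> {1..n}" for i
        using g x that by (auto simp: is_density_def space_sample_law space_PiM)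
      have L: "likelihood f n x {s} > 0"
        using pos by (auto simp: likelihood_def intro!: prod_pos)
      have "(\<Prod>i=1..n. ?h (x i)) = ennreal (\<Prod>i=1..n. sqrt (f t (x i) / f s (x i)))"
        using pos nn by (intro prod_ennreal) (auto simp: less_imp_le)
      also have "(\<Prod>i=1..n. sqrt (f t (x i) / f s (x i)))
          = sqrt (likelihood f n x {t} / likelihood f n x {s})"
        by (simp add: likelihood_def real_sqrt_prod flip: prod_dividef)
      finally have "ennreal (sqrt (1 / c)) * (\<Prod>i=1..n. ?h (x i))
          = ennreal (sqrt (likelihood f n x {t} / (c * likelihood f n x {s})))"
        using c by (simp add: real_sqrt_divide real_sqrt_mult flip: ennreal_mult')
      moreover have "1 \<le> sqrt (likelihood f n x {t} / (c * likelihood f n x {s}))" if "x \<in> ?A"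
        using that c L by simp
      ultimately show "indicator ?A x \<le> ennreal (sqrt (1 / c)) * (\<Prod>i=1..n. ?h (x i))"
        by (auto simp: indicator_def)
    qed
  qed
  also have "\<dots> = ennreal (sqrt (1 / c)) * (\<integral>\<^sup>+x. (\<Prod>i=1..n. ?h (x i)) \<partial>?M)"
    by (rule nn_integral_cmult) measurable
  also have "(\<integral>\<^sup>+x. (\<Prod>i=1..n. ?h (x i)) \<partial>?M) = (\<Prod>i=1..n. \<integral>\<^sup>+x. ?h x \<partial>?D)"
    unfolding sample_law_def by (rule product_nn_integral_prod) auto
  also have "\<dots> = affinity \<nu> (f s) (f t) ^ n"
    by (simp add: nn_integral_sqrt_ratio[OF f g])
  finally show ?thesis .
qed

section \<open>Error probabilities of the likelihood ratio test\<close>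

text \<open>The last conjunct excludes 0/0, where the product inequality holds but the ratio is 0.
  For a positive numerator over 0 the ratio is infinite and both sides are true.\<close>

lemma likelihood_ratio_ge_iff:
  assumes "0 \<le> likelihood f n x {s}" "0 \<le> likelihood f n x {t}" "0 < k"
  shows "ennreal k \<le> likelihood_ratio f {s} {t} n x \<longleftrightarrow>
    k * likelihood f n x {s} \<le> likelihood f n x {t} \<and>
      (likelihood f n x {s} \<noteq> 0 \<or> likelihood f n x {t} \<noteq> 0)"
proof (cases "likelihood f n x {s} = 0")
  case True
  then show ?thesis
    using assms by (cases "likelihood f n x {t} = 0")
      (auto simp: likelihood_ratio_def ennreal_divide_top ennreal_divide_zero)
next
  case False
  then show ?thesis
    using assms by (simp add: likelihood_ratio_def divide_ennreal field_simps ennreal_le_iff)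
qed

lemma likelihood_nonneg:
  assumes "is_density \<nu> (f \<theta>)" "x \<in> space (Pi\<^sub>M {1..n} (\<lambda>_. \<nu>))"
  shows "0 \<le> likelihood f n x {\<theta>}"
  using assms by (auto simp: likelihood_def is_density_def space_PiM intro!: prod_nonneg)

lemma borel_measurable_likelihood_ratio [measurable]:
  assumes [measurable]: "f s \<in> borel_measurable \<nu>" "f t \<in> borel_measurable \<nu>"
  shows "likelihood_ratio f {s} {t} n \<in> borel_measurable (Pi\<^sub>M {1..n} (\<lambda>_. \<nu>))"
  unfolding likelihood_ratio_def by measurable

text \<open>Error of the first kind: the affinity bound with \<open>c = k\<close>. Passing to the
  event without division can only add samples with 0/0. The real number \<open>\<rho>\<close> puts
  the bound in a form suited to limits of reals.\<close>

lemma prob_ratio_ge_under_denominator: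
  assumes f: "is_density \<nu> (f s)" and g: "is_density \<nu> (f t)" and k: "0 < k"
    and \<rho>: "affinity \<nu> (f s) (f t) = ennreal \<rho>" "0 \<le> \<rho>"
  shows "\<P>(x in sample_law \<nu> f n s. ennreal k \<le> likelihood_ratio f {s} {t} n x)
    \<le> sqrt (1 / k) * \<rho> ^ n"
proof -
  have [measurable]: "f s \<in> borel_measurable \<nu>" "f t \<in> borel_measurable \<nu>"
    using f g by (auto simp: is_density_def)
  let ?M = "sample_law \<nu> f n s"
  interpret prob_space ?M by (rule prob_space_sample_law[of \<nu> f, OF f])
  have "ennreal \<P>(x in ?M. ennreal k \<le> likelihood_ratio f {s} {t} n x)
      = emeasure ?M {x \<in> space ?M. ennreal k \<le> likelihood_ratio f {s} {t} n x}"
    by (simp add: emeasure_eq_measure)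
  also have "\<dots> \<le> emeasure ?M {x \<in> space ?M. k * likelihood f n x {s} \<le> likelihood f n x {t}}"
  proof (rule emeasure_mono)
    show "{x \<in> space ?M. ennreal k \<le> likelihood_ratio f {s} {t} n x}
        \<subseteq> {x \<in> space ?M. k * likelihood f n x {s} \<le> likelihood f n x {t}}"
      using f g k by (auto simp: likelihood_ratio_ge_iff likelihood_nonneg space_sample_law)
  qed measurable
  also have "\<dots> \<le> ennreal (sqrt (1 / k)) * affinity \<nu> (f s) (f t) ^ n"
    by (rule sample_law_affinity_bound[OF f g k])
  also have "\<dots> = ennreal (sqrt (1 / k) * \<rho> ^ n)"
    using \<rho> k by (simp add: ennreal_power ennreal_mult)
  finally show ?thesis using \<rho> k by (subst (asm) ennreal_le_iff) auto
qed

text \<open>Error of the second kind, by complement: a ratio below \<open>k\<close> is a reciprocal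
  ratio of at least \<open>1 / k\<close>, so the affinity bound applies with \<open>s\<close> and
  \<open>t\<close> exchanged and \<open>c = 1 / k\<close>.\<close>

lemma prob_ratio_ge_under_numerator:
  assumes f: "is_density \<nu> (f s)" and g: "is_density \<nu> (f t)" and k: "0 < k"
    and \<rho>: "affinity \<nu> (f s) (f t) = ennreal \<rho>" "0 \<le> \<rho>"
  shows "1 - sqrt k * \<rho> ^ n
    \<le> \<P>(x in sample_law \<nu> f n t. ennreal k \<le> likelihood_ratio f {s} {t} n x)"
proof -
  have [measurable]: "f s \<in> borel_measurable \<nu>" "f t \<in> borel_measurable \<nu>"
    using f g by (auto simp: is_density_def)
  let ?M = "sample_law \<nu> f n t"
  interpret prob_space ?M by (rule prob_space_sample_law[of \<nu> f, OF g])
  let ?B = "{x \<in> space ?M. (1 / k) * likelihood f n x {t} \<le> likelihood f n x {s}}"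
  have "ennreal (prob ?B) = emeasure ?M ?B"
    by (simp add: emeasure_eq_measure)
  also have "\<dots> \<le> ennreal (sqrt (1 / (1 / k))) * affinity \<nu> (f t) (f s) ^ n"
    using k by (intro sample_law_affinity_bound[OF g f]) simp
  also have "\<dots> = ennreal (sqrt k * \<rho> ^ n)"
    using \<rho> k by (simp add: affinity_commute[of \<nu> "f t"] ennreal_power ennreal_mult)
  finally have "prob ?B \<le> sqrt k * \<rho> ^ n"
    using \<rho> k by (subst (asm) ennreal_le_iff) auto
  moreover have "prob {x \<in> space ?M. \<not> ennreal k \<le> likelihood_ratio f {s} {t} n x} \<le> prob ?B"
  proof (rule finite_measure_mono)
    show "{x \<in> space ?M. \<not> ennreal k \<le> likelihood_ratio f {s} {t} n x} \<subseteq> ?B"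
    proof (rule subsetI)
      fix x assume "x \<in> {x \<in> space ?M. \<not> ennreal k \<le> likelihood_ratio f {s} {t} n x}"
      then have x: "x \<in> space ?M" and n: "\<not> ennreal k \<le> likelihood_ratio f {s} {t} n x"
        by auto
      have nn: "0 \<le> likelihood f n x {s}" "0 \<le> likelihood f n x {t}"
        using x f g by (auto simp: space_sample_law intro: likelihood_nonneg)
      \<comment> \<open>Missing the threshold means either the strict inequality or 0/0; the weak
        inequality covers both.\<close>
      then have "likelihood f n x {t} \<le> k * likelihood f n x {s}"
        using n k by (auto simp: likelihood_ratio_ge_iff)
      then show "x \<in> ?B"
        using x k by (simp add: field_simps)
    qed
  qed measurable
  moreover have "\<P>(x in ?M. \<not> ennreal k \<le> likelihood_ratio f {s} {t} n x)
      = 1 - \<P>(x in ?M. ennreal k \<le> likelihood_ratio f {s} {t} n x)"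
    by (rule prob_neg) measurable
  ultimately show ?thesis by simp
qed

text \<open>Two versions of one density give ratio 1 almost surely, so the threshold must exceed 1
  here, whereas the bounds above hold for every positive \<open>k\<close>.\<close>

lemma prob_ratio_ge_eq_0:
  assumes f: "is_density \<nu> (f s)" and g: "is_density \<nu> (f t)" and k: "1 < k"
    and eq: "AE x in \<nu>. f s x = f t x"
  shows "\<P>(x in sample_law \<nu> f n s. ennreal k \<le> likelihood_ratio f {s} {t} n x) = 0"
proof -
  have [measurable]: "f s \<in> borel_measurable \<nu>" "f t \<in> borel_measurable \<nu>"
    using f g by (auto simp: is_density_def)
  let ?M = "sample_law \<nu> f n s"
  interpret prob_space ?M by (rule prob_space_sample_law[of \<nu> f, OF f])
  have "AE x in density \<nu> (\<lambda>x. ennreal (f s x)). 0 < f s x \<and> f s x = f t x"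
    using AE_density_pos[OF f] eq by (auto simp: AE_density)
  from AE_sample_law[of \<nu> f s, OF f this, of n]
  have "AE x in ?M. \<not> ennreal k \<le> likelihood_ratio f {s} {t} n x"
  proof (rule AE_mp, intro AE_I2 impI)
    fix x assume x: "\<forall>i\<in>{1..n}. 0 < f s (x i) \<and> f s (x i) = f t (x i)"
    have pos: "likelihood f n x {s} > 0" and "likelihood f n x {t} = likelihood f n x {s}"
      using x by (auto simp: likelihood_def intro!: prod_pos prod.cong)
    then show "\<not> ennreal k \<le> likelihood_ratio f {s} {t} n x"
      using k by (simp add: likelihood_ratio_ge_iff)
  qed
  then show ?thesis by (subst prob_eq_0) auto
qed

section \<open>Two-level sampling with a two-point prior\<close>

lemma measure_joint_law:
  assumes p: "prob_space p" "space p = {s, t}" "{s} \<in> sets p" "{t} \<in> sets p" "s \<noteq> t"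
    and f: "is_density \<nu> (f s)" and g: "is_density \<nu> (f t)"
    and X: "X \<in> sets (p \<Otimes>\<^sub>M Pi\<^sub>M {1..n} (\<lambda>_. \<nu>))"
  shows "measure (joint_law \<nu> f p n) X =
      measure p {s} * measure (sample_law \<nu> f n s) (Pair s -` X)
    + measure p {t} * measure (sample_law \<nu> f n t) (Pair t -` X)"
proof -
  interpret p: prob_space p by fact
  let ?N = "p \<Otimes>\<^sub>M Pi\<^sub>M {1..n} (\<lambda>_. \<nu>)"
  let ?K = "\<lambda>\<theta>. distr (sample_law \<nu> f n \<theta>) ?N (\<lambda>x. (\<theta>, x))"
  have S: "prob_space (sample_law \<nu> f n \<theta>)" if "\<theta> \<in> {s, t}" for \<theta>
    using that f g by (auto intro: prob_space_sample_law)
  have Pair: "Pair \<theta> \<in> sample_law \<nu> f n \<theta> \<rightarrow>\<^sub>M ?N" if "\<theta> \<in> {s, t}" for \<theta>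
  proof -
    have "\<theta> \<in> space p" using that p(2) by simp
    then show ?thesis by measurable
  qed
  have K: "?K \<in> p \<rightarrow>\<^sub>M subprob_algebra ?N"
  proof (rule measurableI)
    fix \<theta> assume "\<theta> \<in> space p"
    then have *: "\<theta> \<in> {s, t}" using p by simp
    from prob_space.prob_space_distr[OF S[OF *] Pair[OF *]]
    show "?K \<theta> \<in> space (subprob_algebra ?N)"
      by (auto simp: space_subprob_algebra intro: prob_space_imp_subprob_space)
  next
    fix A
    \<comment> \<open>The kernel is measurable because all four subsets of the two-point parameter
      space are.\<close>
    have "?K -` A \<inter> space p \<in> {{}, {s}, {t}, {s} \<union> {t}}"
      using p(2) by auto
    then show "?K -` A \<inter> space p \<in> sets p"
      using p(3,4) sets.Un[OF p(3,4)] by auto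
  qed
  have *: "emeasure (?K \<theta>) X = ennreal (measure (sample_law \<nu> f n \<theta>) (Pair \<theta> -` X))"
    if "\<theta> \<in> {s, t}" for \<theta>
  proof -
    interpret prob_space "sample_law \<nu> f n \<theta>" by (rule S[OF that])
    have "Pair \<theta> -` X \<subseteq> space (sample_law \<nu> f n \<theta>)"
      using sets.sets_into_space[OF X] by (auto simp: space_pair_measure space_sample_law)
    then have "Pair \<theta> -` X \<inter> space (sample_law \<nu> f n \<theta>) = Pair \<theta> -` X" by blast
    then show ?thesis
      unfolding emeasure_distr[OF Pair[OF that] X] by (simp add: emeasure_eq_measure)
  qed
  have "emeasure (joint_law \<nu> f p n) X = (\<integral>\<^sup>+\<theta>. emeasure (?K \<theta>) X \<partial>p)"
    unfolding joint_law_def using p(2) by (intro emeasure_bind[OF _ K X]) auto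
  \<comment> \<open>On two points every integrand is a combination of the indicators of the
    points.\<close>
  also have "\<dots> = (\<integral>\<^sup>+\<theta>. emeasure (?K s) X * indicator {s} \<theta> + emeasure (?K t) X * indicator {t} \<theta> \<partial>p)"
    using p(2,5) by (intro nn_integral_cong) (auto simp: indicator_def)
  also have "\<dots> = emeasure (?K s) X * emeasure p {s} + emeasure (?K t) X * emeasure p {t}"
    using p(3,4) by (subst nn_integral_add) (auto simp: nn_integral_cmult_indicator)
  also have "\<dots> = ennreal (measure p {s} * measure (sample_law \<nu> f n s) (Pair s -` X)
    + measure p {t} * measure (sample_law \<nu> f n t) (Pair t -` X))"
    using *[of s] *[of t]
    by (simp only: insert_iff simp_thms p.emeasure_eq_measure ennreal_mult ennreal_plus
        measure_nonneg mult_nonneg_nonneg mult.commute)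
  finally show ?thesis by (rule measure_eq_emeasure_eq_ennreal[rotated]) simp
qed

text \<open>Bayes' formula. In the numerator the section at \<open>t\<close> is empty. For a
  conditioning event of probability 0 both sides are 0, by division by 0.\<close>

lemma cond_prob_joint_law:
  assumes p: "prob_space p" "space p = {s, t}" "{s} \<in> sets p" "{t} \<in> sets p" "s \<noteq> t"
    and f: "is_density \<nu> (f s)" and g: "is_density \<nu> (f t)"
    and Q: "Measurable.pred (Pi\<^sub>M {1..n} (\<lambda>_. \<nu>)) Q"
  defines "a \<equiv> \<P>(x in sample_law \<nu> f n s. Q x)" and "b \<equiv> \<P>(x in sample_law \<nu> f n t. Q x)"
  shows "\<P>(\<omega> in joint_law \<nu> f p n. fst \<omega> \<in> {s} \<bar> Q (snd \<omega>))
    = measure p {s} * a / (measure p {s} * a + measure p {t} * b)"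
proof -
  let ?N = "p \<Otimes>\<^sub>M Pi\<^sub>M {1..n} (\<lambda>_. \<nu>)"
  have sp: "space (joint_law \<nu> f p n) = space ?N"
    unfolding joint_law_def using p(2) by (subst space_bind[where N = ?N]) auto
  have J: "measure (joint_law \<nu> f p n) X =
      measure p {s} * measure (sample_law \<nu> f n s) (Pair s -` X)
    + measure p {t} * measure (sample_law \<nu> f n t) (Pair t -` X)" if "X \<in> sets ?N" for X
    by (rule measure_joint_law[of p s t \<nu> f, OF p f g that])
  have [measurable]: "{s} \<in> sets p" by fact
  note Q [measurable]
  have "{\<omega> \<in> space ?N. fst \<omega> \<in> {s} \<and> Q (snd \<omega>)} \<in> sets ?N" by measurable
  note J[OF this]
  also have "Pair s -` {\<omega> \<in> space ?N. fst \<omega> \<in> {s} \<and> Q (snd \<omega>)}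
      = {x \<in> space (sample_law \<nu> f n s). Q x}"
    using p(2) by (auto simp: space_pair_measure space_sample_law)
  also have "Pair t -` {\<omega> \<in> space ?N. fst \<omega> \<in> {s} \<and> Q (snd \<omega>)} = {}"
    using p(5) by auto
  finally have H1: "measure (joint_law \<nu> f p n) {\<omega> \<in> space ?N. fst \<omega> \<in> {s} \<and> Q (snd \<omega>)}
      = measure p {s} * a"
    by (simp add: a_def)
  have "{\<omega> \<in> space ?N. Q (snd \<omega>)} \<in> sets ?N" by measurable
  note J[OF this]
  also have "Pair s -` {\<omega> \<in> space ?N. Q (snd \<omega>)} = {x \<in> space (sample_law \<nu> f n s). Q x}"
    using p(2) by (auto simp: space_pair_measure space_sample_law)
  also have "Pair t -` {\<omega> \<in> space ?N. Q (snd \<omega>)} = {x \<in> space (sample_law \<nu> f n t). Q x}"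
    using p(2) by (auto simp: space_pair_measure space_sample_law)
  finally have "measure (joint_law \<nu> f p n) {\<omega> \<in> space ?N. Q (snd \<omega>)}
      = measure p {s} * a + measure p {t} * b"
    by (simp add: a_def b_def)
  with H1 show ?thesis by (simp only: cond_prob_def sp)
qed

section \<open>Consistency of the likelihood ratio\<close>

theorem proposition2:
  fixes \<nu> :: "(real ^ 'k) measure"
    and f :: "real ^ 'l \<Rightarrow> real ^ 'k \<Rightarrow> real"
    and \<Theta> \<Theta>\<^sub>1 \<Theta>\<^sub>2 :: "(real ^ 'l) set"
    and p :: "(real ^ 'l) measure"
    and k\<^sub>S :: real
  assumes "\<nu> = lborel \<or> \<nu> = count_space UNIV"
    and "\<And>\<theta>. \<theta> \<in> \<Theta> \<Longrightarrow> is_density \<nu> (f \<theta>)"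
    and "\<And>\<theta> \<theta>'. \<theta> \<in> \<Theta> \<Longrightarrow> \<theta>' \<in> \<Theta> \<Longrightarrow> \<theta> \<noteq> \<theta>' \<Longrightarrow> f \<theta> \<noteq> f \<theta>'"
    and "is_singleton \<Theta>\<^sub>1" and "is_singleton \<Theta>\<^sub>2"
    and "\<Theta>\<^sub>1 \<inter> \<Theta>\<^sub>2 = {}" and "\<Theta>\<^sub>1 \<union> \<Theta>\<^sub>2 = \<Theta>"
    and "prob_space p" and "sets p = sets (restrict_space borel \<Theta>)"
    and "0 < measure p \<Theta>\<^sub>1" and "measure p \<Theta>\<^sub>1 < 1"
    and "k\<^sub>S > 1"
  shows "consistent_evidence \<nu> f p \<Theta>\<^sub>1 (likelihood_ratio f \<Theta>\<^sub>1 \<Theta>\<^sub>2) {ennreal k\<^sub>S..}"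
proof -
  obtain s t where s: "\<Theta>\<^sub>1 = {s}" and t: "\<Theta>\<^sub>2 = {t}"
    using assms(4,5) by (auto simp: is_singleton_def)
  have st: "s \<noteq> t" and \<Theta>: "\<Theta> = {s, t}" using assms(6,7) s t by auto
  interpret p: prob_space p by fact
  have sp: "space p = {s, t}"
    using sets_eq_imp_space_eq[OF assms(9)] \<Theta> by (simp add: space_restrict_space)
  \<comment> \<open>Sets outside the sigma-algebra have measure 0 by default, so positive mass
    forces measurability.\<close>
  have s_sets: "{s} \<in> sets p"
    using assms(10) s measure_notin_sets[of "{s}" p] by fastforce
  have t_eq: "{t} = space p - {s}" using sp st by auto
  have t_sets: "{t} \<in> sets p" unfolding t_eq using s_sets by auto
  have pt: "measure p {t} > 0"
    unfolding t_eq using assms(11) s p.prob_compl[OF s_sets] by simp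
  have f: "is_density \<nu> (f s)" and g: "is_density \<nu> (f t)"
    using assms(2) \<Theta> by auto
  have [measurable]: "f s \<in> borel_measurable \<nu>" "f t \<in> borel_measurable \<nu>"
    using f g by (auto simp: is_density_def)
  have k: "0 < k\<^sub>S" using assms(12) by simp
  define a where "a n = \<P>(x in sample_law \<nu> f n s. ennreal k\<^sub>S \<le> likelihood_ratio f {s} {t} n x)" for n
  define b where "b n = \<P>(x in sample_law \<nu> f n t. ennreal k\<^sub>S \<le> likelihood_ratio f {s} {t} n x)" for n
  have cond: "\<P>(\<omega> in joint_law \<nu> f p n. fst \<omega> \<in> \<Theta>\<^sub>1 \<bar>
        likelihood_ratio f \<Theta>\<^sub>1 \<Theta>\<^sub>2 n (snd \<omega>) \<in> {ennreal k\<^sub>S..})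
      = measure p {s} * a n / (measure p {s} * a n + measure p {t} * b n)" for n
    unfolding a_def b_def s t atLeast_iff
    by (rule cond_prob_joint_law[OF \<open>prob_space p\<close> sp s_sets t_sets st f g]) measurable
  have "(\<lambda>n. measure p {s} * a n / (measure p {s} * a n + measure p {t} * b n)) \<longlonglongrightarrow> 0"
    using affinity_less_1_or_AE_eq[OF f g]
  proof
    \<comment> \<open>In this case the two sample laws coincide, so \<open>b n\<close> is 0 as well:
      the conditioning event is null and the conditional probability takes its default value
      0.\<close>
    assume "AE x in \<nu>. f s x = f t x"
    then have "a n = 0" for n
      unfolding a_def by (rule prob_ratio_ge_eq_0[OF f g assms(12)])
    then show ?thesis by simp
  next
    assume less: "affinity \<nu> (f s) (f t) < 1"
    then obtain \<rho> where \<rho>: "affinity \<nu> (f s) (f t) = ennreal \<rho>" "0 \<le> \<rho>" "\<rho> < 1"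
      by (cases "affinity \<nu> (f s) (f t)") auto
    have pow: "(\<lambda>n. \<rho> ^ n) \<longlonglongrightarrow> 0" using \<rho> by (intro LIMSEQ_power_zero) simp
    have a: "a \<longlonglongrightarrow> 0"
    proof (rule tendsto_sandwich[OF always_eventually always_eventually tendsto_const])
      show "\<forall>n. 0 \<le> a n" by (simp add: a_def)
      show "\<forall>n. a n \<le> sqrt (1 / k\<^sub>S) * \<rho> ^ n"
        unfolding a_def using prob_ratio_ge_under_denominator[of \<nu> f, OF f g k \<rho>(1,2)] by blast
      show "(\<lambda>n. sqrt (1 / k\<^sub>S) * \<rho> ^ n) \<longlonglongrightarrow> 0"
        by (rule tendsto_mult_right_zero[OF pow])
    qed
    have b: "b \<longlonglongrightarrow> 1"
    proof (rule tendsto_sandwich[OF always_eventually always_eventually _ tendsto_const])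
      show "\<forall>n. 1 - sqrt k\<^sub>S * \<rho> ^ n \<le> b n"
        unfolding b_def using prob_ratio_ge_under_numerator[of \<nu> f, OF f g k \<rho>(1,2)] by blast
      show "\<forall>n. b n \<le> 1"
        unfolding b_def using prob_space.prob_le_1[OF prob_space_sample_law[of \<nu> f, OF g]] by blast
      show "(\<lambda>n. 1 - sqrt k\<^sub>S * \<rho> ^ n) \<longlonglongrightarrow> 1"
        using tendsto_diff[OF tendsto_const tendsto_mult_right_zero[OF pow]] by fastforce
    qed
    \<comment> \<open>The denominator tends to \<open>measure p {t}\<close>, which is positive since
      \<open>\<Theta>\<^sub>1\<close> has mass below 1; this justifies the limit of the
      quotient.\<close>
    have "(\<lambda>n. measure p {s} * a n / (measure p {s} * a n + measure p {t} * b n))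
        \<longlonglongrightarrow> measure p {s} * 0 / (measure p {s} * 0 + measure p {t} * 1)"
      using pt by (intro tendsto_intros a b) simp
    then show ?thesis by simp
  qed
  then show ?thesis unfolding consistent_evidence_def cond .
qed

end
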